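(* Let $m_1+m_2=n$, $m_1>m_2$, and let $L\in\mathcal{S}_n$ be the Laplacian matrix of an undirected graph on $n$ vertices. Let (N+) be the semidefinite program $$\begin{array}{rl} \min & \frac12\operatorname{tr} L(2X+J-xe^{\mathrm T}-ex^{\mathrm T})\\ \text{s.t.} & x^{\mathrm T}e=m_1,\quad \operatorname{tr}(JX)=m_1^2,\quad Xe=m_1x,\\ & X\ge0,\quad xe^{\mathrm T}-X\ge0,\quad J+X-xe^{\mathrm T}-ex^{\mathrm T}\ge0,\\ & X\succeq0,\quad \operatorname{diag}(X)=x,\quad X=(x_{i,j})\in\mathcal{S}_n, \end{array}$$ with the additional constraints $$x_{i,k}+x_{j,k}\le x_{k,k}+x_{i,j},\qquad x_{i,i}+x_{j,j}+x_{k,k}\le x_{i,j}+x_{i,k}+x_{j,k}+1$$ for all $1\le i,j,k\le n$ with $i\ne j$, $i\ne k$, $j\ne k$. Let (WZ+) be the semidefinite program $$\begin{array}{rl} \min & \frac12\operatorname{tr} L(Y_{11}+Y_{22})\\ \text{s.t.} & \operatorname{tr}(Y_{ii})=m_i,\quad \operatorname{tr}(JY_{ii})=m_i^2,\quad i=1,2,\\ & \operatorname{diag}(Y_{12})=0,\quad \operatorname{tr} J(Y_{12}+Y_{12}^{\mathrm T})=2m_1m_2,\\ & Y=\begin{pmatrix}Y_{11}&Y_{12}\\ Y_{12}^{\mathrm T}&Y_{22}\end{pmatrix}=(y_{i,j})\in\mathcal{S}_{2n},\quad y=\operatorname{diag}(Y),\quad Y-yy^{\mathrm T}\succeq 0,\quad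 Y\ge 0, \end{array}$$ with the additional constraints $$0\le y_{i,j}\le y_{i,i},\qquad y_{i,i}+y_{j,j}\le 1+y_{i,j},$$ $$y_{i,k}+y_{j,k}\le y_{k,k}+y_{i,j},\qquad y_{i,i}+y_{j,j}+y_{k,k}\le y_{i,j}+y_{i,k}+y_{j,k}+1$$ for all $1\le i,j,k\le 2n$ with $i\ne j$, $i\ne k$, $j\ne k$. Then (N+) and (WZ+) are equivalent.
   Context: $m_1,m_2$ are positive integers (the prescribed sizes of the two parts of a bisection of the vertex set of a graph $G$ with $n$ vertices). $A$ is the (possibly edge-weighted) symmetric adjacency matrix of $G$, and $L=\operatorname{Diag}(Ae)-A$ is its Laplacian matrix, where $\operatorname{Diag}(v)$ is the diagonal matrix with diagonal $v$. $\mathcal{S}_k$ is the space of real symmetric $k\times k$ matrices; $e$ is the all-ones vector in $\mathbb{R}^n$; $J=ee^{\mathrm T}$ is the $n\times n$ all-ones matrix; $\operatorname{diag}(M)$ is the vector of diagonal entries of a square matrix $M$; $M\succeq0$ means positive semidefinite; $M\ge0$ means entrywise nonnegative. The blocks $Y_{11},Y_{12},Y_{22}$ are $n\times n$. Two semidefinite relaxations are called equivalent if they give the same bound, i.e. their optimal values are equal (with the convention that the minimum over an empty feasible set is $+\infty$). *)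

theory Defs
  imports "HOL-Analysis.Analysis"
begin

text \<open>
  Vertices are the elements of a finite type \<open>'n\<close>, so \<open>n = CARD('n)\<close>.  Matrices of order \<open>2n\<close>
  are indexed by \<open>'n + 'n\<close>, with \<open>Inl\<close> and \<open>Inr\<close> selecting the first and the second block.
\<close>

definition ones :: "real ^ 'n"
  where "ones = (\<chi> i. 1)"

definition outer :: "real ^ 'm \<Rightarrow> real ^ 'n \<Rightarrow> real ^ 'n ^ 'm"
  where "outer u v = (\<chi> i j. u $ i * v $ j)"

definition ones_mat :: "real ^ 'n ^ 'n"
  where "ones_mat = outer ones ones"

definition diag_vec :: "real ^ 'n ^ 'n \<Rightarrow> real ^ 'n"
  where "diag_vec M = (\<chi> i. M $ i $ i)"

definition diag_mat :: "real ^ 'n \<Rightarrow> real ^ 'n ^ 'n"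
  where "diag_mat v = (\<chi> i j. if i = j then v $ i else 0)"

definition sym_mat :: "real ^ 'n ^ 'n \<Rightarrow> bool"
  where "sym_mat M \<longleftrightarrow> transpose M = M"

definition psd :: "real ^ 'n ^ 'n \<Rightarrow> bool"
  where "psd M \<longleftrightarrow> sym_mat M \<and> (\<forall>v. 0 \<le> v \<bullet> (M *v v))"

text \<open>
  An undirected graph without loops is a set of two-element sets of vertices.  The weights are
  arbitrary reals; the unweighted case is \<open>w = (\<lambda>_. 1)\<close>.
\<close>

definition undirected_graph :: "'n set set \<Rightarrow> bool"
  where "undirected_graph E \<longleftrightarrow> (\<forall>e\<in>E. card e = 2)"

definition adjacency_matrix :: "'n set set \<Rightarrow> ('n set \<Rightarrow> real) \<Rightarrow> real ^ 'n ^ 'n"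
  where "adjacency_matrix E w = (\<chi> i j. if {i, j} \<in> E then w {i, j} else 0)"

definition laplacian :: "real ^ 'n ^ 'n \<Rightarrow> real ^ 'n ^ 'n"
  where "laplacian A = diag_mat (A *v ones) - A"

text \<open>
  The optimal value of a minimization problem; it is \<open>\<infinity>\<close> if the feasible set is empty.
\<close>

definition min_value :: "('a \<Rightarrow> real) \<Rightarrow> 'a set \<Rightarrow> ereal"
  where "min_value f F = (INF z\<in>F. ereal (f z))"

text \<open>
  Below, \<open>\<le>\<close> between matrices is the entrywise order, whereas \<open>psd\<close> is the semidefinite one.
\<close>

definition N_plus_feasible :: "nat \<Rightarrow> ((real ^ 'n) \<times> (real ^ 'n ^ 'n)) set"
  where "N_plus_feasible m1 = {(x, X).
    x \<bullet> ones = real m1 \<and>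
    trace (ones_mat ** X) = (real m1)\<^sup>2 \<and>
    X *v ones = real m1 *\<^sub>R x \<and>
    0 \<le> X \<and>
    0 \<le> outer x ones - X \<and>
    0 \<le> ones_mat + X - outer x ones - outer ones x \<and>
    psd X \<and>
    diag_vec X = x \<and>
    sym_mat X \<and>
    (\<forall>i j k. i \<noteq> j \<and> i \<noteq> k \<and> j \<noteq> k \<longrightarrow>
      X $ i $ k + X $ j $ k \<le> X $ k $ k + X $ i $ j \<and>
      X $ i $ i + X $ j $ j + X $ k $ k \<le> X $ i $ j + X $ i $ k + X $ j $ k + 1)}"

definition N_plus_objective :: "real ^ 'n ^ 'n \<Rightarrow> (real ^ 'n) \<times> (real ^ 'n ^ 'n) \<Rightarrow> real"
  where "N_plus_objective L = (\<lambda>(x, X).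
    1 / 2 * trace (L ** (2 *\<^sub>R X + ones_mat - outer x ones - outer ones x)))"

definition N_plus_value :: "real ^ 'n ^ 'n \<Rightarrow> nat \<Rightarrow> ereal"
  where "N_plus_value L m1 = min_value (N_plus_objective L) (N_plus_feasible m1)"

definition block11 :: "real ^ ('n::finite + 'n) ^ ('n + 'n) \<Rightarrow> real ^ 'n ^ 'n"
  where "block11 Y = (\<chi> i j. Y $ Inl i $ Inl j)"

definition block12 :: "real ^ ('n::finite + 'n) ^ ('n + 'n) \<Rightarrow> real ^ 'n ^ 'n"
  where "block12 Y = (\<chi> i j. Y $ Inl i $ Inr j)"

definition block22 :: "real ^ ('n::finite + 'n) ^ ('n + 'n) \<Rightarrow> real ^ 'n ^ 'n"
  where "block22 Y = (\<chi> i j. Y $ Inr i $ Inr j)"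

text \<open>
  The lower left block of \<open>Y\<close> is \<open>transpose (block12 Y)\<close> because \<open>Y\<close> is required to be symmetric.
\<close>

definition WZ_plus_feasible :: "nat \<Rightarrow> nat \<Rightarrow> (real ^ ('n::finite + 'n) ^ ('n + 'n)) set"
  where "WZ_plus_feasible m1 m2 = {Y.
    trace (block11 Y) = real m1 \<and>
    trace (block22 Y) = real m2 \<and>
    trace (ones_mat ** block11 Y) = (real m1)\<^sup>2 \<and>
    trace (ones_mat ** block22 Y) = (real m2)\<^sup>2 \<and>
    diag_vec (block12 Y) = 0 \<and>
    trace (ones_mat ** (block12 Y + transpose (block12 Y))) = 2 * real m1 * real m2 \<and>
    sym_mat Y \<and>
    psd (Y - outer (diag_vec Y) (diag_vec Y)) \<and>
    0 \<le> Y \<and>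
    (\<forall>i j k. i \<noteq> j \<and> i \<noteq> k \<and> j \<noteq> k \<longrightarrow>
      0 \<le> Y $ i $ j \<and> Y $ i $ j \<le> Y $ i $ i \<and>
      Y $ i $ i + Y $ j $ j \<le> 1 + Y $ i $ j \<and>
      Y $ i $ k + Y $ j $ k \<le> Y $ k $ k + Y $ i $ j \<and>
      Y $ i $ i + Y $ j $ j + Y $ k $ k \<le> Y $ i $ j + Y $ i $ k + Y $ j $ k + 1)}"

definition WZ_plus_objective :: "real ^ 'n ^ 'n \<Rightarrow> real ^ ('n + 'n) ^ ('n + 'n) \<Rightarrow> real"
  where "WZ_plus_objective L Y = 1 / 2 * trace (L ** (block11 Y + block22 Y))"

definition WZ_plus_value :: "real ^ 'n ^ 'n \<Rightarrow> nat \<Rightarrow> nat \<Rightarrow> ereal"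
  where "WZ_plus_value L m1 m2 = min_value (WZ_plus_objective L) (WZ_plus_feasible m1 m2)"

end

theory Submission imports Defs
begin

text \<open>
  Read \<open>X $ i $ j\<close> as the probability that the vertices \<open>i\<close> and \<open>j\<close> both lie in the first part of
  a random bisection.  The probabilities of the three other placements of the pair are then
  determined: \<open>x\<^sub>i - X\<^sub>i\<^sub>j\<close>, \<open>x\<^sub>j - X\<^sub>i\<^sub>j\<close> and \<open>1 + X\<^sub>i\<^sub>j - x\<^sub>i - x\<^sub>j\<close>.  Writing them into the blocks of a
  matrix of order \<open>2n\<close> gives a map \<open>complement_lift\<close> from the first program to the second which
  preserves the objective.  The theorem holds because this map carries the feasible set of the first
  program \<^emph>\<open>onto\<close> that of the second (\<open>WZ_plus_feasible_eq_image\<close>).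

  The lift of a feasible point is feasible (\<open>complement_lift_feasible\<close>) for two reasons.  The family
  of triangle inequalities is closed under replacing an event by its complement.  And the covariance
  matrix of the lift is \<open>(C, -C; -C, C)\<close> with \<open>C = X - x x\<^sup>T\<close>, so that it is semidefinite exactly when
  \<open>C\<close> is; the latter follows from \<open>X \<succeq> 0\<close>, \<open>X e = m\<^sub>1 x\<close> and \<open>x\<^sup>T e = m\<^sub>1\<close>.

  Conversely, let \<open>Y\<close> be feasible for the second program, and let \<open>i\<close> and \<open>i'\<close> be the two copies of
  a vertex.  Since \<open>y\<^sub>i\<^sub>i\<^sub>' = 0\<close>, we have \<open>y\<^sub>i + y\<^sub>i\<^sub>' \<le> 1\<close>, and the prescribed traces add up to \<open>n\<close>, so
  \<open>y\<^sub>i + y\<^sub>i\<^sub>' = 1\<close>.  The two triangle inequalities for \<open>i, i', k\<close> now become \<open>y\<^sub>i\<^sub>k + y\<^sub>i\<^sub>'\<^sub>k = y\<^sub>k\<^sub>k\<close>, which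
  says that \<open>Y\<close> is the lift of its first block \<open>X\<close>.  The only linear constraint on \<open>X\<close> that is not
  immediate is \<open>X e = m\<^sub>1 x\<close>; it holds because \<open>e\<^sup>T (X - x x\<^sup>T) e = m\<^sub>1\<^sup>2 - m\<^sub>1\<^sup>2 = 0\<close> and a semidefinite
  matrix annihilates every vector on which its quadratic form vanishes.
\<close>

section \<open>Entries, traces and quadratic forms\<close>

lemma ones_nth [simp]: "ones $ i = 1"
  by (simp add: ones_def)

lemma outer_nth [simp]: "outer u v $ i $ j = u $ i * v $ j"
  by (simp add: outer_def)

lemma ones_mat_nth [simp]: "ones_mat $ i $ j = 1"
  by (simp add: ones_mat_def)

lemma diag_vec_nth [simp]: "diag_vec M $ i = M $ i $ i"
  by (simp add: diag_vec_def)

lemma block_nth [simp]: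
  "block11 Y $ i $ j = Y $ Inl i $ Inl j"
  "block12 Y $ i $ j = Y $ Inl i $ Inr j"
  "block22 Y $ i $ j = Y $ Inr i $ Inr j"
  by (simp_all add: block11_def block12_def block22_def)

lemma sym_mat_iff: "sym_mat M \<longleftrightarrow> (\<forall>i j. M $ i $ j = M $ j $ i)"
  by (auto simp: sym_mat_def transpose_def vec_eq_iff)

lemma mat_nonneg_iff:
  fixes M :: "real ^ 'n ^ 'm"
  shows "0 \<le> M \<longleftrightarrow> (\<forall>i j. 0 \<le> M $ i $ j)"
  by (simp add: less_eq_vec_def)

lemma sum_UNIV_sum_type:
  fixes f :: "'a::finite + 'b::finite \<Rightarrow> 'c::comm_monoid_add"
  shows "sum f UNIV = (\<Sum>i\<in>UNIV. f (Inl i)) + (\<Sum>i\<in>UNIV. f (Inr i))"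
  by (simp add: UNIV_Plus_UNIV [symmetric] sum.Plus del: UNIV_Plus_UNIV)

lemma trace_ones_mat_mult:
  fixes M :: "real ^ 'n ^ 'n"
  shows "trace (ones_mat ** M) = (\<Sum>i\<in>UNIV. \<Sum>j\<in>UNIV. M $ i $ j)"
  unfolding trace_def matrix_matrix_mult_def by (simp, rule sum.swap)

lemma inner_ones: "x \<bullet> ones = (\<Sum>i\<in>UNIV. x $ i)"
  by (simp add: inner_vec_def)

lemma inner_matrix_sym:
  fixes M :: "real ^ 'n ^ 'n"
  assumes "sym_mat M"
  shows "u \<bullet> (M *v v) = v \<bullet> (M *v u)"
  using assms by (metis dot_lmul_matrix inner_commute sym_mat_def transpose_matrix_vector)

lemma outer_mult_vec: "outer x y *v v = (y \<bullet> v) *\<^sub>R x"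
  by (simp add: vec_eq_iff matrix_vector_mult_def inner_vec_def sum_distrib_left algebra_simps)

lemma sym_outer: "sym_mat (outer x x)"
  by (simp add: sym_mat_iff)

lemma sym_mat_diff: "sym_mat M \<Longrightarrow> sym_mat N \<Longrightarrow> sym_mat (M - N)"
  by (simp add: sym_mat_iff)

section \<open>Semidefinite matrices\<close>

text \<open>
  Moving from \<open>v\<close> a distance \<open>t\<close> against \<open>M v\<close> changes the quadratic form by
  \<open>- 2 t |M v|\<^sup>2 + O(t\<^sup>2)\<close>, so for small \<open>t > 0\<close> it would become negative if \<open>M v\<close>
  were nonzero.
\<close>

lemma psd_kernel:
  fixes M :: "real ^ 'n ^ 'n"
  assumes M: "psd M" and v: "v \<bullet> (M *v v) = 0"
  shows "M *v v = 0"
proof (rule ccontr)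
  assume nz: "M *v v \<noteq> 0"
  define u where "u = M *v v"
  define a where "a = u \<bullet> u"
  define c where "c = u \<bullet> (M *v u)"
  have a: "a > 0" using nz by (simp add: a_def u_def)
  have c: "c \<ge> 0" using M by (simp add: psd_def c_def)
  have sym: "v \<bullet> (M *v u) = a"
    using inner_matrix_sym M by (metis a_def u_def psd_def)
  have form: "0 \<le> t\<^sup>2 * c - 2 * t * a" for t
  proof -
    have "0 \<le> (v - t *\<^sub>R u) \<bullet> (M *v (v - t *\<^sub>R u))"
      using M by (simp add: psd_def)
    also have "\<dots> = v \<bullet> (M *v v) - t * (v \<bullet> (M *v u)) - t * (u \<bullet> (M *v v)) + t\<^sup>2 * c"
      by (simp add: matrix_vector_mult_diff_distrib matrix_vector_mult_scaleR c_def
          inner_diff_left inner_diff_right power2_eq_square algebra_simps)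
    also have "u \<bullet> (M *v v) = a" by (simp add: a_def u_def)
    finally show ?thesis using v sym by (simp add: algebra_simps)
  qed
  \<comment> \<open>The value \<open>t = a / (c + 1)\<close> is close to the minimizer \<open>a / c\<close> and avoids a case split on \<open>c = 0\<close>.\<close>
  define t where "t = a / (c + 1)"
  have t: "0 < t" and tc: "t * c \<le> a"
    using a c by (simp_all add: t_def field_simps)
  have "t\<^sup>2 * c = t * (t * c)" by (simp add: power2_eq_square)
  also have "\<dots> \<le> t * a" using t tc by simp
  also have "\<dots> < 2 * t * a" using t a by simp
  finally show False using form [of t] by simp
qed

text \<open>
  This replaces the Schur complement condition on the bordered matrix \<open>(1, x\<^sup>T; x, X)\<close>: that matrix
  is a congruence transform of \<open>X\<close>, because \<open>x\<close> is the image of \<open>e / m\<close> under \<open>X\<close>.  Concretely,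
  \<open>v\<^sup>T (X - x x\<^sup>T) v\<close> is the form of \<open>X\<close> at the translate of \<open>v\<close> along \<open>e\<close> that is orthogonal to \<open>x\<close>.
\<close>

lemma psd_minus_outer:
  fixes X :: "real ^ 'n ^ 'n"
  assumes X: "psd X" and Xe: "X *v e = m *\<^sub>R x" and xe: "x \<bullet> e = m" and m: "m \<noteq> 0"
  shows "psd (X - outer x x)"
  unfolding psd_def
proof (intro conjI allI)
  show "sym_mat (X - outer x x)"
    using X by (simp add: psd_def sym_mat_diff sym_outer)
  fix v
  define t where "t = (x \<bullet> v) / m"
  have tm: "t * m = x \<bullet> v" using m by (simp add: t_def)
  have eXv: "e \<bullet> (X *v v) = m * (x \<bullet> v)"
    using inner_matrix_sym [of X e v] X Xe by (simp add: psd_def inner_commute)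
  have "0 \<le> (v - t *\<^sub>R e) \<bullet> (X *v (v - t *\<^sub>R e))"
    using X by (simp add: psd_def)
  also have "\<dots> = v \<bullet> (X *v v) - t * (v \<bullet> (X *v e)) - t * (e \<bullet> (X *v v)) + t\<^sup>2 * (e \<bullet> (X *v e))"
    by (simp add: matrix_vector_mult_diff_distrib matrix_vector_mult_scaleR
        inner_diff_left inner_diff_right power2_eq_square algebra_simps)
  also have "\<dots> = v \<bullet> (X *v v) - 2 * (t * m) * (x \<bullet> v) + (t * m)\<^sup>2"
    using xe by (simp add: eXv Xe inner_commute power2_eq_square)
  also have "\<dots> = v \<bullet> ((X - outer x x) *v v)"
    unfolding tm by (simp add: matrix_vector_mult_diff_rdistrib outer_mult_vec inner_diff_right
        inner_commute power2_eq_square)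
  finally show "0 \<le> v \<bullet> ((X - outer x x) *v v)" .
qed

lemma psd_plus_outer:
  fixes X :: "real ^ 'n ^ 'n"
  assumes "psd (X - outer x x)"
  shows "psd X"
  unfolding psd_def
proof (intro conjI allI)
  have "sym_mat (X - outer x x)" using assms by (simp add: psd_def)
  then show "sym_mat X" by (simp add: sym_mat_iff mult.commute)
  fix v
  have "0 \<le> v \<bullet> ((X - outer x x) *v v)" using assms by (simp add: psd_def)
  also have "\<dots> = v \<bullet> (X *v v) - (x \<bullet> v)\<^sup>2"
    by (simp add: matrix_vector_mult_diff_rdistrib outer_mult_vec inner_diff_right
        inner_commute power2_eq_square)
  also have "\<dots> \<le> v \<bullet> (X *v v)" by simp
  finally show "0 \<le> v \<bullet> (X *v v)" .
qed

section \<open>Adjoining complementary events\<close>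

text \<open>
  The joint probabilities of the events \<open>Inl i\<close> and of their complements \<open>Inr i\<close>, computed from the
  joint probabilities \<open>X\<close> of the events \<open>Inl i\<close> alone.
\<close>

definition complement_lift :: "real ^ 'n ^ 'n \<Rightarrow> real ^ ('n::finite + 'n) ^ ('n + 'n)"
  where "complement_lift X = (\<chi> p q.
    case (p, q) of
      (Inl i, Inl j) \<Rightarrow> X $ i $ j
    | (Inl i, Inr j) \<Rightarrow> X $ i $ i - X $ i $ j
    | (Inr i, Inl j) \<Rightarrow> X $ j $ j - X $ j $ i
    | (Inr i, Inr j) \<Rightarrow> 1 + X $ i $ j - X $ i $ i - X $ j $ j)"

lemma complement_lift_nth [simp]:
  "complement_lift X $ Inl i $ Inl j = X $ i $ j"
  "complement_lift X $ Inl i $ Inr j = X $ i $ i - X $ i $ j"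
  "complement_lift X $ Inr i $ Inl j = X $ j $ j - X $ j $ i"
  "complement_lift X $ Inr i $ Inr j = 1 + X $ i $ j - X $ i $ i - X $ j $ j"
  by (simp_all add: complement_lift_def)

lemma sym_complement_lift:
  assumes "sym_mat X"
  shows "sym_mat (complement_lift X)"
  unfolding sym_mat_iff
proof (intro allI)
  fix p q
  have "X $ i $ j = X $ j $ i" for i j using assms by (simp add: sym_mat_iff)
  then show "complement_lift X $ p $ q = complement_lift X $ q $ p"
    by (cases p; cases q) simp_all
qed

text \<open>
  The covariance of two indicators changes sign when one of the events is complemented.  Hence the
  form of the lifted covariance matrix at \<open>(v\<^sub>1, v\<^sub>2)\<close> is that of the original one at \<open>v\<^sub>1 - v\<^sub>2\<close>.
\<close>

lemma complement_lift_covariance_form: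
  fixes X :: "real ^ 'n ^ 'n" and v :: "real ^ ('n::finite + 'n)"
  assumes "sym_mat X"
  defines "Y \<equiv> complement_lift X"
  defines "w \<equiv> (\<chi> i. v $ Inl i - v $ Inr i)"
  shows "v \<bullet> ((Y - outer (diag_vec Y) (diag_vec Y)) *v v) =
    w \<bullet> ((X - outer (diag_vec X) (diag_vec X)) *v w)"
proof -
  define C where "C = X - outer (diag_vec X) (diag_vec X)"
  define D where "D = Y - outer (diag_vec Y) (diag_vec Y)"
  have sym: "X $ i $ j = X $ j $ i" for i j using assms(1) by (simp add: sym_mat_iff)
  have D: "D $ Inl i $ Inl j = C $ i $ j" "D $ Inl i $ Inr j = - C $ i $ j"
    "D $ Inr i $ Inl j = - C $ i $ j" "D $ Inr i $ Inr j = C $ i $ j" for i j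
    using sym [of i j] by (simp_all add: D_def C_def Y_def algebra_simps)
  have "(D *v v) $ Inl i = (C *v w) $ i" "(D *v v) $ Inr i = - (C *v w) $ i" for i
    by (simp_all add: matrix_vector_mult_def sum_UNIV_sum_type D w_def
        right_diff_distrib sum_subtractf sum_negf)
  then have "v \<bullet> (D *v v) = w \<bullet> (C *v w)"
    by (simp add: inner_vec_def sum_UNIV_sum_type w_def left_diff_distrib sum_subtractf sum_negf)
  then show ?thesis by (simp add: C_def D_def)
qed

lemma psd_complement_lift_iff:
  fixes X :: "real ^ 'n ^ 'n"
  assumes X: "sym_mat X"
  defines "Y \<equiv> complement_lift X"
  shows "psd (Y - outer (diag_vec Y) (diag_vec Y)) \<longleftrightarrow>
    psd (X - outer (diag_vec X) (diag_vec X))"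
    (is "psd ?D \<longleftrightarrow> psd ?C")
proof
  assume D: "psd ?D"
  have "0 \<le> u \<bullet> (?C *v u)" for u
  proof -
    define v :: "real ^ ('n + 'n)" where
      "v = (\<chi> p. case p of Inl i \<Rightarrow> u $ i | Inr i \<Rightarrow> 0)"
    have u: "u = (\<chi> i. v $ Inl i - v $ Inr i)" by (simp add: v_def vec_eq_iff)
    have "v \<bullet> (?D *v v) = u \<bullet> (?C *v u)"
      unfolding u Y_def by (rule complement_lift_covariance_form [OF X])
    then show ?thesis using D by (metis psd_def)
  qed
  then show "psd ?C" using X by (simp add: psd_def sym_mat_diff sym_outer)
next
  assume C: "psd ?C"
  have "0 \<le> v \<bullet> (?D *v v)" for v
    using C complement_lift_covariance_form [OF X, of v] by (simp add: psd_def Y_def)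
  then show "psd ?D"
    using X by (simp add: psd_def sym_mat_diff sym_outer sym_complement_lift Y_def)
qed

lemma complement_lift_objective:
  assumes "diag_vec X = x"
  shows "WZ_plus_objective L (complement_lift X) = N_plus_objective L (x, X)"
proof -
  have "block11 (complement_lift X) + block22 (complement_lift X) =
      2 *\<^sub>R X + ones_mat - outer x ones - outer ones x"
    using assms by (auto simp: vec_eq_iff)
  then show ?thesis by (simp add: WZ_plus_objective_def N_plus_objective_def)
qed

text \<open>
  For events \<open>A, B, C\<close> the two kinds of triangle inequality say that
  \<open>P(C - A - B) + P(A \<inter> B - C) \<ge> 0\<close> and that \<open>P(A \<inter> B \<inter> C) + P(- A - B - C) \<ge> 0\<close>.  Complementing
  some of the events permutes these inequalities, which settles the case of three different
  vertices.  If two of the three indices are the copies of one vertex, the inequalities reduce to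
  the entrywise bounds.
\<close>

lemma complement_lift_triangle:
  fixes X :: "real ^ 'n ^ 'n"
  assumes sym: "sym_mat X"
    and nonneg: "\<And>i j. 0 \<le> X $ i $ j"
    and le_diag: "\<And>i j. X $ i $ j \<le> X $ i $ i"
    and union: "\<And>i j. X $ i $ i + X $ j $ j \<le> 1 + X $ i $ j"
    and tri1: "\<And>i j k. i \<noteq> j \<Longrightarrow> i \<noteq> k \<Longrightarrow> j \<noteq> k \<Longrightarrow>
      X $ i $ k + X $ j $ k \<le> X $ k $ k + X $ i $ j"
    and tri2: "\<And>i j k. i \<noteq> j \<Longrightarrow> i \<noteq> k \<Longrightarrow> j \<noteq> k \<Longrightarrow>
      X $ i $ i + X $ j $ j + X $ k $ k \<le> X $ i $ j + X $ i $ k + X $ j $ k + 1"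
  defines "Y \<equiv> complement_lift X"
  assumes ne: "p \<noteq> q" "p \<noteq> r" "q \<noteq> r"
  shows "Y $ p $ r + Y $ q $ r \<le> Y $ r $ r + Y $ p $ q"
    and "Y $ p $ p + Y $ q $ q + Y $ r $ r \<le> Y $ p $ q + Y $ p $ r + Y $ q $ r + 1"
proof -
  define vertex :: "'n + 'n \<Rightarrow> 'n" where "vertex = case_sum id id"
  define i j k where "i = vertex p" and "j = vertex q" and "k = vertex r"
  have p: "p = Inl i \<or> p = Inr i" and q: "q = Inl j \<or> q = Inr j" and r: "r = Inl k \<or> r = Inr k"
    by (cases p; cases q; cases r; simp add: i_def j_def k_def vertex_def)+
  have s: "X $ j $ i = X $ i $ j" "X $ k $ i = X $ i $ k" "X $ k $ j = X $ j $ k"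
    using sym by (simp_all add: sym_mat_iff)
  have n: "0 \<le> X $ i $ j" "0 \<le> X $ i $ k" "0 \<le> X $ j $ k"
    by (rule nonneg)+
  have d: "X $ i $ j \<le> X $ i $ i" "X $ i $ k \<le> X $ i $ i" "X $ j $ k \<le> X $ j $ j"
    "X $ i $ j \<le> X $ j $ j" "X $ i $ k \<le> X $ k $ k" "X $ j $ k \<le> X $ k $ k"
    using le_diag s by metis+
  have u: "X $ i $ i + X $ j $ j \<le> 1 + X $ i $ j" "X $ i $ i + X $ k $ k \<le> 1 + X $ i $ k"
    "X $ j $ j + X $ k $ k \<le> 1 + X $ j $ k"
    by (rule union)+
  have "Y $ p $ r + Y $ q $ r \<le> Y $ r $ r + Y $ p $ q \<and>
    Y $ p $ p + Y $ q $ q + Y $ r $ r \<le> Y $ p $ q + Y $ p $ r + Y $ q $ r + 1"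
  proof (cases "i = j \<or> i = k \<or> j = k")
    case True
    then show ?thesis
      using p q r ne n d u s unfolding Y_def by (elim disjE) simp_all
  next
    case False
    then have t: "X $ i $ k + X $ j $ k \<le> X $ k $ k + X $ i $ j"
      "X $ i $ j + X $ j $ k \<le> X $ j $ j + X $ i $ k"
      "X $ i $ j + X $ i $ k \<le> X $ i $ i + X $ j $ k"
      "X $ i $ i + X $ j $ j + X $ k $ k \<le> X $ i $ j + X $ i $ k + X $ j $ k + 1"
      using tri1 [of i j k] tri1 [of i k j] tri1 [of j k i] tri2 [of i j k] s by auto
    show ?thesis
      using p q r t s unfolding Y_def by (elim disjE) simp_all
  qed
  then show "Y $ p $ r + Y $ q $ r \<le> Y $ r $ r + Y $ p $ q"
    and "Y $ p $ p + Y $ q $ q + Y $ r $ r \<le> Y $ p $ q + Y $ p $ r + Y $ q $ r + 1"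
    by auto
qed

section \<open>The feasible sets correspond\<close>

lemma complement_lift_feasible:
  fixes X :: "real ^ 'n ^ 'n"
  assumes feas: "(x, X) \<in> N_plus_feasible m1"
    and m1: "0 < m1" and card: "m1 + m2 = CARD('n)"
  shows "complement_lift X \<in> WZ_plus_feasible m1 m2"
proof -
  define Y where "Y = complement_lift X"
  have x: "x $ i = X $ i $ i" for i
    using feas by (auto simp: N_plus_feasible_def)
  have xe: "x \<bullet> ones = m1" and Xe: "X *v ones = real m1 *\<^sub>R x"
    and JX: "(\<Sum>i\<in>UNIV. \<Sum>j\<in>UNIV. X $ i $ j) = (real m1)\<^sup>2"
    and psdX: "psd X" and symX: "sym_mat X"
    using feas by (auto simp: N_plus_feasible_def trace_ones_mat_mult)
  have xd: "diag_vec X = x" using x by (simp add: vec_eq_iff)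
  have nonneg: "0 \<le> X $ i $ j" and le_diag: "X $ i $ j \<le> X $ i $ i"
    and union: "X $ i $ i + X $ j $ j \<le> 1 + X $ i $ j" for i j
  proof -
    have "0 \<le> X $ i $ j" "0 \<le> (outer x ones - X) $ i $ j"
      "0 \<le> (ones_mat + X - outer x ones - outer ones x) $ i $ j"
      using feas unfolding N_plus_feasible_def mat_nonneg_iff by auto
    then show "0 \<le> X $ i $ j" "X $ i $ j \<le> X $ i $ i"
      "X $ i $ i + X $ j $ j \<le> 1 + X $ i $ j"
      by (simp_all add: x)
  qed
  have tri: "X $ i $ k + X $ j $ k \<le> X $ k $ k + X $ i $ j"
    "X $ i $ i + X $ j $ j + X $ k $ k \<le> X $ i $ j + X $ i $ k + X $ j $ k + 1"
    if "i \<noteq> j" "i \<noteq> k" "j \<noteq> k" for i j k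
    using feas that by (auto simp: N_plus_feasible_def)
  have n: "real CARD('n) = real m1 + real m2" using card by (metis of_nat_add)
  have trX: "(\<Sum>i\<in>UNIV. X $ i $ i) = real m1" using xe by (simp add: inner_ones x)
  have le_diag': "X $ i $ j \<le> X $ j $ j" for i j
    using le_diag [of j i] symX by (simp add: sym_mat_iff)
  have Y_nonneg: "0 \<le> Y $ p $ q" for p q
    using nonneg le_diag le_diag' union by (cases p; cases q) (simp_all add: Y_def algebra_simps)
  have Y_le: "Y $ p $ q \<le> Y $ p $ p" for p q
    using nonneg le_diag le_diag' union symX
    by (cases p; cases q) (simp_all add: Y_def algebra_simps sym_mat_iff)
  have Y_union: "Y $ p $ p + Y $ q $ q \<le> 1 + Y $ p $ q" for p q
    using nonneg le_diag le_diag' union symX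
    by (cases p; cases q) (simp_all add: Y_def algebra_simps sym_mat_iff)
  have Y_tri: "Y $ p $ r + Y $ q $ r \<le> Y $ r $ r + Y $ p $ q"
    "Y $ p $ p + Y $ q $ q + Y $ r $ r \<le> Y $ p $ q + Y $ p $ r + Y $ q $ r + 1"
    if "p \<noteq> q" "p \<noteq> r" "q \<noteq> r" for p q r
    using complement_lift_triangle [OF symX nonneg le_diag union tri that]
    unfolding Y_def by auto
  have "psd (X - outer x x)"
    using psd_minus_outer [OF psdX Xe xe] m1 by simp
  then have "psd (Y - outer (diag_vec Y) (diag_vec Y))"
    using psd_complement_lift_iff [OF symX] by (simp add: Y_def xd)
  moreover have "trace (block11 Y) = m1" "trace (block22 Y) = m2"
    by (simp_all add: trace_def Y_def trX sum_subtractf n)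
  moreover have "trace (ones_mat ** block11 Y) = (real m1)\<^sup>2"
    by (simp add: trace_ones_mat_mult Y_def JX)
  moreover have "trace (ones_mat ** block22 Y) = (real m2)\<^sup>2"
    by (simp add: trace_ones_mat_mult Y_def JX sum_subtractf sum.distrib trX n
        sum_distrib_left [symmetric] power2_eq_square algebra_simps)
  moreover have "diag_vec (block12 Y) = 0"
    by (simp add: vec_eq_iff Y_def)
  moreover have "trace (ones_mat ** (block12 Y + transpose (block12 Y))) = 2 * real m1 * real m2"
  proof -
    have "(\<Sum>i\<in>UNIV. \<Sum>j\<in>UNIV. X $ j $ i) = (real m1)\<^sup>2"
      using JX by (subst sum.swap)
    then show ?thesis
      by (simp add: trace_ones_mat_mult Y_def JX sum_subtractf sum.distrib trX n transpose_def
          sum_distrib_left [symmetric] power2_eq_square algebra_simps)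
  qed
  moreover have "sym_mat Y" using symX by (simp add: Y_def sym_complement_lift)
  moreover have "0 \<le> Y" using Y_nonneg by (simp add: mat_nonneg_iff)
  ultimately show ?thesis
    unfolding WZ_plus_feasible_def Y_def [symmetric]
    using Y_nonneg Y_le Y_union Y_tri by blast
qed

text \<open>
  The pair inequality for \<open>Inl i, Inr i\<close> is imposed in the presence of a third index, hence the
  assumption that there are at least two vertices.
\<close>

lemma WZ_plus_complementary:
  fixes Y :: "real ^ ('n::finite + 'n) ^ ('n + 'n)"
  assumes feas: "Y \<in> WZ_plus_feasible m1 m2"
    and card: "m1 + m2 = CARD('n)" and two: "2 \<le> CARD('n)"
  shows "Y $ Inl i $ Inl i + Y $ Inr i $ Inr i = 1"
proof -
  have tr: "(\<Sum>i\<in>UNIV. Y $ Inl i $ Inl i) = m1" "(\<Sum>i\<in>UNIV. Y $ Inr i $ Inr i) = m2"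
    and d: "Y $ Inl i $ Inr i = 0" for i
    using feas by (auto simp: WZ_plus_feasible_def trace_def vec_eq_iff)
  have le: "Y $ Inl i $ Inl i + Y $ Inr i $ Inr i \<le> 1" for i
  proof -
    have "\<exists>j::'n. j \<noteq> i"
    proof (rule ccontr)
      assume "\<not> ?thesis"
      then have "(UNIV :: 'n set) = {i}" by auto
      then have "CARD('n) = 1" by (metis card_1_singleton_iff One_nat_def)
      with two show False by simp
    qed
    then obtain j where "j \<noteq> i" by blast
    then have "Inl i \<noteq> (Inr i :: 'n + 'n)" "Inl i \<noteq> (Inl j :: 'n + 'n)"
      "Inr i \<noteq> (Inl j :: 'n + 'n)"
      by auto
    then have "Y $ Inl i $ Inl i + Y $ Inr i $ Inr i \<le> 1 + Y $ Inl i $ Inr i"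
      using feas unfolding WZ_plus_feasible_def by blast
    then show ?thesis by (simp add: d)
  qed
  have "(\<Sum>i\<in>UNIV. 1 - (Y $ Inl i $ Inl i + Y $ Inr i $ Inr i)) = 0"
    using card by (simp add: sum_subtractf sum.distrib tr flip: of_nat_add)
  then have "\<forall>i\<in>UNIV. 1 - (Y $ Inl i $ Inl i + Y $ Inr i $ Inr i) = 0"
    using le by (subst (asm) sum_nonneg_eq_0_iff) auto
  then show ?thesis by simp
qed

lemma WZ_plus_is_complement_lift:
  fixes Y :: "real ^ ('n::finite + 'n) ^ ('n + 'n)"
  assumes feas: "Y \<in> WZ_plus_feasible m1 m2"
    and card: "m1 + m2 = CARD('n)" and two: "2 \<le> CARD('n)"
  shows "Y = complement_lift (block11 Y)"
proof -
  have d: "Y $ Inl i $ Inr i = 0" for i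
    using feas by (auto simp: WZ_plus_feasible_def vec_eq_iff)
  have sym: "Y $ p $ q = Y $ q $ p" for p q
    using feas by (auto simp: WZ_plus_feasible_def sym_mat_iff)
  have compl: "Y $ Inl i $ Inl i + Y $ Inr i $ Inr i = 1" for i
    by (rule WZ_plus_complementary [OF assms])
  have split: "Y $ Inl i $ r + Y $ Inr i $ r = Y $ r $ r" for i r
  proof (cases "r = Inl i \<or> r = Inr i")
    case True
    then show ?thesis using d [of i] sym [of "Inr i" "Inl i"] by auto
  next
    case False
    then have "Inl i \<noteq> r" "Inr i \<noteq> r" by auto
    then have "Y $ Inl i $ r + Y $ Inr i $ r \<le> Y $ r $ r + Y $ Inl i $ Inr i"
      "Y $ Inl i $ Inl i + Y $ Inr i $ Inr i + Y $ r $ r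
        \<le> Y $ Inl i $ Inr i + Y $ Inl i $ r + Y $ Inr i $ r + 1"
      using feas unfolding WZ_plus_feasible_def by blast+
    then show ?thesis using compl [of i] d [of i] by linarith
  qed
  have "Y $ p $ q = complement_lift (block11 Y) $ p $ q" for p q
  proof (cases p; cases q)
    fix i j assume "p = Inl i" "q = Inl j"
    then show ?thesis by simp
  next
    fix i j assume "p = Inl i" "q = Inr j"
    then show ?thesis using split [of j "Inl i"] by (simp add: sym)
  next
    fix i j assume "p = Inr i" "q = Inl j"
    then show ?thesis using split [of i "Inl j"] by (simp add: sym)
  next
    fix i j assume "p = Inr i" "q = Inr j"
    then show ?thesis
      using split [of i "Inr j"] split [of j "Inl i"] compl [of i] compl [of j]
        sym [of "Inl j" "Inl i"]
        sym [of "Inr j" "Inl i"]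
      by simp
  qed
  then show ?thesis by (simp add: vec_eq_iff)
qed

lemma WZ_plus_block_feasible:
  fixes Y :: "real ^ ('n::finite + 'n) ^ ('n + 'n)"
  assumes feas: "Y \<in> WZ_plus_feasible m1 m2"
    and card: "m1 + m2 = CARD('n)" and two: "2 \<le> CARD('n)"
  defines "X \<equiv> block11 Y"
  shows "(diag_vec X, X) \<in> N_plus_feasible m1"
proof -
  define x where "x = diag_vec X"
  have YX: "Y = complement_lift X"
    unfolding X_def by (rule WZ_plus_is_complement_lift [OF feas card two])
  have Y_nonneg: "0 \<le> Y $ p $ q" for p q
    using feas by (auto simp: WZ_plus_feasible_def mat_nonneg_iff)
  have symX: "sym_mat X"
    using feas by (simp add: WZ_plus_feasible_def sym_mat_iff X_def)
  have JX: "trace (ones_mat ** X) = (real m1)\<^sup>2" and xe: "x \<bullet> ones = m1"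
    using feas by (simp_all add: WZ_plus_feasible_def X_def x_def inner_ones trace_def)
  have C: "psd (X - outer x x)"
    using feas psd_complement_lift_iff [OF symX]
    by (simp add: WZ_plus_feasible_def x_def flip: YX)
  have "ones \<bullet> (X *v ones) = (real m1)\<^sup>2"
    using JX by (simp add: trace_ones_mat_mult inner_vec_def matrix_vector_mult_def)
  then have "ones \<bullet> ((X - outer x x) *v ones) = 0"
    using xe by (simp add: matrix_vector_mult_diff_rdistrib outer_mult_vec inner_diff_right
        inner_commute power2_eq_square)
  then have "(X - outer x x) *v ones = 0"
    by (rule psd_kernel [OF C])
  then have Xe: "X *v ones = real m1 *\<^sub>R x"
    using xe by (simp add: matrix_vector_mult_diff_rdistrib outer_mult_vec)
  have "0 \<le> X" using Y_nonneg by (simp add: mat_nonneg_iff X_def)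
  moreover have "0 \<le> outer x ones - X"
    unfolding mat_nonneg_iff
  proof (intro allI)
    fix i j show "0 \<le> (outer x ones - X) $ i $ j"
      using Y_nonneg [of "Inl i" "Inr j"] by (simp add: YX x_def)
  qed
  moreover have "0 \<le> ones_mat + X - outer x ones - outer ones x"
    unfolding mat_nonneg_iff
  proof (intro allI)
    fix i j show "0 \<le> (ones_mat + X - outer x ones - outer ones x) $ i $ j"
      using Y_nonneg [of "Inr i" "Inr j"] by (simp add: YX x_def)
  qed
  moreover have "X $ i $ k + X $ j $ k \<le> X $ k $ k + X $ i $ j \<and>
      X $ i $ i + X $ j $ j + X $ k $ k \<le> X $ i $ j + X $ i $ k + X $ j $ k + 1"
    if "i \<noteq> j" "i \<noteq> k" "j \<noteq> k" for i j k
  proof -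
    have "Inl i \<noteq> (Inl j :: 'n + 'n)" "Inl i \<noteq> (Inl k :: 'n + 'n)" "Inl j \<noteq> (Inl k :: 'n + 'n)"
      using that by simp_all
    then show ?thesis
      using feas unfolding WZ_plus_feasible_def X_def block_nth by blast
  qed
  ultimately show ?thesis
    using xe JX Xe psd_plus_outer [OF C] symX
    by (simp add: N_plus_feasible_def flip: x_def)
qed

lemma WZ_plus_feasible_eq_image:
  assumes "0 < m1" and "0 < m2" and "m1 + m2 = CARD('n::finite)"
  shows "WZ_plus_feasible m1 m2 =
    (\<lambda>(x, X). complement_lift X) ` (N_plus_feasible m1 :: ((real ^ 'n) \<times> (real ^ 'n ^ 'n)) set)"
    (is "?W = ?f ` ?N")
proof
  have two: "2 \<le> CARD('n)" using assms by linarith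
  show "?W \<subseteq> ?f ` ?N"
  proof
    fix Y assume Y: "Y \<in> ?W"
    have "Y = ?f (diag_vec (block11 Y), block11 Y)"
      using WZ_plus_is_complement_lift [OF Y assms(3) two] by simp
    then show "Y \<in> ?f ` ?N"
      using WZ_plus_block_feasible [OF Y assms(3) two] by (rule image_eqI)
  qed
  show "?f ` ?N \<subseteq> ?W"
    using complement_lift_feasible assms by fast
qed

section \<open>Equality of the optimal values\<close>

theorem theorem5:
  fixes E :: "'n::finite set set" and w :: "'n set \<Rightarrow> real"
    and L :: "real ^ 'n ^ 'n" and m1 m2 :: nat
  assumes "undirected_graph E"
    and "L = laplacian (adjacency_matrix E w)"
    and "0 < m1" and "0 < m2"
    and "m1 + m2 = CARD('n)"
    and "m1 > m2"
  shows "N_plus_value L m1 = WZ_plus_value L m1 m2"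
proof -
  have "WZ_plus_objective L (complement_lift X) = N_plus_objective L (x, X)"
    if "(x, X) \<in> N_plus_feasible m1" for x and X :: "real ^ 'n ^ 'n"
    using that by (intro complement_lift_objective) (simp add: N_plus_feasible_def)
  then show ?thesis
    unfolding N_plus_value_def WZ_plus_value_def min_value_def
      WZ_plus_feasible_eq_image [OF assms(3-5)] image_image
    by (intro INF_cong) auto
qed

end
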